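(* Let $a,b\in\mathbb{Z}$ with $\gcd(a,b)=1$. If $a^2+ab-b^2\equiv 0\pmod 5$, then $M_{(a,b)}=M_L=\{2,4,6,7,14\}\cup\{3^j:j\ge1\}$. Otherwise $M_{(a,b)}=M_F$, where $M_F=\{5^k,\,2\cdot5^k,\,4\cdot5^k,\,3^j\cdot5^k,\,6\cdot5^k,\,7\cdot5^k,\,14\cdot5^k : k\ge0,\ j\ge1\}\setminus\{1\}$.
   Context: For integers $a,b$ with $\gcd(a,b)=1$, the Gibonacci sequence $\{G_n(a,b)\}_{n\ge1}$ is defined by $G_1=a$, $G_2=b$, $G_{n+1}=G_{n-1}+G_n$. A sequence is complete mod $m$ if every residue class modulo $m$ contains some term of the sequence. $M_{(a,b)}$ denotes the set of integers $m\ge2$ such that $\{G_n(a,b)\}$ is complete mod $m$; $M_F=M_{(1,1)}$ (Fibonacci) and $M_L=M_{(1,3)}$ (Lucas). *)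

theory Defs
  imports Main "HOL-Number_Theory.Cong"
begin

text \<open>Gibonacci sequence, 1-indexed: G 1 = a, G 2 = b, G (n+1) = G (n-1) + G n.
  The value at index 0 is irrelevant (never used by completeness) and set to b - a.\<close>
fun gib :: "int \<Rightarrow> int \<Rightarrow> nat \<Rightarrow> int" where
  "gib a b 0 = b - a"
| "gib a b (Suc 0) = a"
| "gib a b (Suc (Suc 0)) = b"
| "gib a b (Suc (Suc (Suc n))) = gib a b (Suc n) + gib a b (Suc (Suc n))"

definition complete_mod :: "int \<Rightarrow> int \<Rightarrow> int \<Rightarrow> bool" where
  "complete_mod a b m \<longleftrightarrow> (\<forall>r::int. \<exists>n\<ge>1. [gib a b n = r] (mod m))"

definition Mset :: "int \<Rightarrow> int \<Rightarrow> int set" where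
  "Mset a b = {m. m \<ge> 2 \<and> complete_mod a b m}"

end

theory Submission
  imports Defs "HOL-Number_Theory.Euler_Criterion"
begin

text \<open>
  Consecutive terms satisfy \<open>G\<^sub>n\<^sup>2 + G\<^sub>n G\<^sub>n\<^sub>+\<^sub>1 - G\<^sub>n\<^sub>+\<^sub>1\<^sup>2 = \<plusminus>D\<close> with \<open>D = a\<^sup>2 + a b - b\<^sup>2\<close>. Hence a residue \<open>x\<close>
  can occur modulo a prime \<open>p\<close> only if \<open>5 x\<^sup>2 + 4 D\<close> or \<open>5 x\<^sup>2 - 4 D\<close> is a square modulo \<open>p\<close>. Summing
  Legendre symbols over \<open>x\<close> shows that both are non-residues for some \<open>x\<close> as soon as \<open>p > 7\<close> and
  \<open>p \<nmid> D\<close>; if \<open>p\<close> divides \<open>D\<close>, the residue 0 is missed. The moduli 8, 12, 21, 28 and 49 are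
  excluded by the same invariant and a finite search, and 18 because all terms divisible by 9 have
  the same parity. The remaining moduli are the listed ones.

  Conversely, if \<open>A\<^sup>P = 1 + m C\<close> for the companion matrix \<open>A\<close>, then \<open>G\<^bsub>n+tP\<^esub> = G\<^sub>n + t m (C G)\<^sub>n\<close> modulo
  \<open>q m\<close> for \<open>q = 3\<close> and \<open>q = 5\<close>, so every residue modulo \<open>m\<close> lifts to all residues modulo \<open>q m\<close>
  provided that \<open>(C G)\<^sub>n\<close> is a unit modulo \<open>q\<close>. For \<open>q = 5\<close> this holds for all \<open>n\<close> if \<open>5 \<nmid> D\<close>, because
  \<open>C\<close> is then a multiple of the nilpotent matrix \<open>A + 2\<close> modulo 5. Only the moduli 3, 4, 6 and 14
  need to be checked by enumeration.
\<close>

section \<open>Legendre symbol sums\<close>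

locale odd_prime =
  fixes p :: nat
  assumes prime_p: "prime p" and p_gt_2: "2 < p"
begin

abbreviation chi :: "int \<Rightarrow> int" where "chi a \<equiv> Legendre a (int p)"
abbreviation reps :: "int set" where "reps \<equiv> {0..<int p}"

lemma prime_int_p: "prime (int p)"
  using prime_p by simp

lemma chi_cong: "[a = b] (mod int p) \<Longrightarrow> chi a = chi b"
  by (simp add: Legendre_def QuadRes_def cong_def)

lemma chi_cases: "chi a = -1 \<or> chi a = 0 \<or> chi a = 1"
  by (auto simp: Legendre_def)

lemma chi_eq_0_iff: "chi a = 0 \<longleftrightarrow> int p dvd a"
  by (auto simp: Legendre_def cong_0_iff)

text \<open>Values in {-1, 0, 1} differ by at most 2 < \<open>p\<close>, so congruences such as
  Euler's criterion yield equalities.\<close>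

lemma chi_eqI:
  assumes "[chi a = c] (mod int p)" "c = -1 \<or> c = 0 \<or> c = 1"
  shows "chi a = c"
proof -
  have "int p dvd chi a - c" using assms(1) by (simp add: cong_iff_dvd_diff)
  moreover have "\<bar>chi a - c\<bar> < int p" using chi_cases[of a] assms(2) p_gt_2 by auto
  ultimately show ?thesis using zdvd_imp_le[of "int p" "\<bar>chi a - c\<bar>"] by force
qed

lemma chi_mult: "chi (a * b) = chi a * chi b"
proof (rule chi_eqI)
  let ?k = "(p - 1) div 2"
  have "[chi (a * b) = (a * b) ^ ?k] (mod int p)" by (rule euler_criterion[OF prime_p p_gt_2])
  moreover have "[chi a * chi b = a ^ ?k * b ^ ?k] (mod int p)"
    by (intro cong_mult euler_criterion[OF prime_p p_gt_2])
  ultimately show "[chi (a * b) = chi a * chi b] (mod int p)"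
    by (metis cong_sym cong_trans power_mult_distrib)
  show "chi a * chi b = -1 \<or> chi a * chi b = 0 \<or> chi a * chi b = 1"
    using chi_cases[of a] chi_cases[of b] by auto
qed

lemma chi_square: "\<not> int p dvd a \<Longrightarrow> chi (a\<^sup>2) = 1"
  using chi_cases[of a] chi_eq_0_iff[of a] by (auto simp: power2_eq_square chi_mult)

lemma chi_minus_1: "chi (-1) = (-1) ^ ((p - 1) div 2)"
proof (rule chi_eqI)
  show "[chi (-1) = (-1) ^ ((p - 1) div 2)] (mod int p)" by (rule euler_criterion[OF prime_p p_gt_2])
qed (cases "even ((p - 1) div 2)"; simp)

lemma chi_eq_1_iff: "chi a = 1 \<longleftrightarrow> \<not> int p dvd a \<and> (\<exists>y. [y\<^sup>2 = a] (mod int p))"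
  by (auto simp: Legendre_def QuadRes_def cong_0_iff)

lemma not_dvd_numeral_2: "\<not> int p dvd 2"
  using p_gt_2 by (auto dest: zdvd_imp_le)

text \<open>As \<open>u\<close> is invertible modulo \<open>p\<close>, the residues are merely
  permuted: the change of variables for the sums below.\<close>

lemma sum_affine:
  fixes f :: "int \<Rightarrow> int"
  assumes per: "\<And>x y. [x = y] (mod int p) \<Longrightarrow> f x = f y" and u: "\<not> int p dvd u"
  shows "(\<Sum>x\<in>reps. f (u * x + v)) = (\<Sum>x\<in>reps. f x)"
proof -
  let ?g = "\<lambda>x. (u * x + v) mod int p"
  have p0: "int p > 0" using p_gt_2 by simp
  have cop: "coprime u (int p)"
    using u prime_int_p by (metis coprime_commute prime_imp_coprime)
  have inj: "inj_on ?g reps"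
  proof (rule inj_onI)
    fix x y assume xy: "x \<in> reps" "y \<in> reps" "?g x = ?g y"
    then have "[u * x + v = u * y + v] (mod int p)" by (simp add: cong_def)
    then have "[u * x = u * y] (mod int p)" by (simp add: cong_add_rcancel)
    then have "[x = y] (mod int p)" using cop cong_mult_lcancel by blast
    with xy show "x = y" by (simp add: cong_def)
  qed
  have "?g ` reps = reps"
    using p0 by (intro endo_inj_surj inj) auto
  then have bij: "bij_betw ?g reps reps" using inj by (simp add: bij_betw_def)
  have "(\<Sum>x\<in>reps. f (u * x + v)) = (\<Sum>x\<in>reps. f (?g x))"
    by (intro sum.cong per) (auto simp: cong_def)
  also have "\<dots> = (\<Sum>x\<in>reps. f x)" by (rule sum.reindex_bij_betw[OF bij])
  finally show ?thesis .
qed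

text \<open>If \<open>y\<close> is a root, the roots are \<open>y\<close> and \<open>- y\<close>
  modulo \<open>p\<close>, and these coincide exactly when \<open>p\<close> divides
  \<open>a\<close>.\<close>

lemma card_square_roots: "int (card {y \<in> reps. [y\<^sup>2 = a] (mod int p)}) = 1 + chi a"
proof (cases "\<exists>y. [y\<^sup>2 = a] (mod int p)")
  case False
  then have "chi a = -1" by (auto simp: Legendre_def QuadRes_def) (metis cong_0_iff cong_sym dvd_refl power_zero_numeral)+
  moreover have "{y \<in> reps. [y\<^sup>2 = a] (mod int p)} = {}" using False by auto
  ultimately show ?thesis by (simp only: card.empty)
next
  case True
  then obtain y0 where y0: "[y0\<^sup>2 = a] (mod int p)" by blast
  define y where "y = y0 mod int p"
  have p0: "int p > 0" using p_gt_2 by simp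
  have y: "[y\<^sup>2 = a] (mod int p)" using y0 by (simp add: y_def cong_def power_mod)
  have yR: "0 \<le> y" "y < int p" using p0 by (auto simp: y_def)
  have root: "z = y \<or> z + y = 0 \<or> z + y = int p" if "z \<in> reps" "[z\<^sup>2 = a] (mod int p)" for z
  proof -
    have "[z\<^sup>2 = y\<^sup>2] (mod int p)" using that(2) y by (meson cong_sym cong_trans)
    then have "int p dvd (z - y) * (z + y)"
      by (simp add: cong_iff_dvd_diff power2_eq_square algebra_simps)
    then consider "int p dvd z - y" | "int p dvd z + y"
      using prime_int_p prime_dvd_mult_iff by blast
    then show ?thesis
    proof cases
      case 1
      then have "[z = y] (mod int p)" by (simp add: cong_iff_dvd_diff)
      then show ?thesis using that yR by (simp add: cong_def)
    next
      case 2
      then obtain k where k: "z + y = int p * k" by blast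
      have "0 \<le> int p * k" "int p * k < int p * 2" unfolding k[symmetric] using that yR by auto
      then have "0 \<le> k" "k < 2" using p0 by (auto simp: zero_le_mult_iff)
      then have "k = 0 \<or> k = 1" by auto
      then show ?thesis using k by auto
    qed
  qed
  show ?thesis
  proof (cases "int p dvd a")
    case True
    then have "int p dvd y\<^sup>2" using y by (simp add: cong_dvd_iff)
    then have "int p dvd y" using prime_int_p prime_dvd_power by blast
    then have "y = 0" using yR by (meson dual_order.strict_iff_order zdvd_not_zless order_le_less)
    then have "{z \<in> reps. [z\<^sup>2 = a] (mod int p)} = {0}" using root y p0 by fastforce
    then show ?thesis using True chi_eq_0_iff[of a] by simp
  next
    case False
    then have "chi a = 1" using y chi_eq_1_iff by blast
    have "\<not> int p dvd y\<^sup>2" using y False by (simp add: cong_dvd_iff)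
    then have "y \<noteq> 0" by auto
    have "odd (int p)" using prime_p p_gt_2 prime_odd_nat by simp
    then have ne: "y \<noteq> int p - y" by presburger
    have "(int p - y)\<^sup>2 = y\<^sup>2 + int p * (int p - 2 * y)" by (simp add: power2_eq_square algebra_simps)
    then have "[(int p - y)\<^sup>2 = a] (mod int p)" using y by (simp add: cong_def)
    then have "{z \<in> reps. [z\<^sup>2 = a] (mod int p)} = {y, int p - y}"
      using root y yR \<open>y \<noteq> 0\<close> by fastforce
    then show ?thesis using ne \<open>chi a = 1\<close> by simp
  qed
qed

text \<open>Group the \<open>x\<close> by \<open>t = x^2\<close>; each \<open>t\<close> has
  \<open>1 + chi t\<close> square roots.\<close>

lemma sum_square_arg:
  fixes f :: "int \<Rightarrow> int"
  assumes per: "\<And>x y. [x = y] (mod int p) \<Longrightarrow> f x = f y"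
  shows "(\<Sum>x\<in>reps. f (x\<^sup>2)) = (\<Sum>t\<in>reps. (1 + chi t) * f t)"
proof -
  have p0: "int p > 0" using p_gt_2 by simp
  have "(\<Sum>x\<in>reps. f (x\<^sup>2)) = (\<Sum>t\<in>reps. \<Sum>x\<in>{x\<in>reps. x\<^sup>2 mod int p = t}. f (x\<^sup>2))"
    by (rule sum.group[symmetric]) (use p0 in auto)
  also have "\<dots> = (\<Sum>t\<in>reps. (1 + chi t) * f t)"
  proof (rule sum.cong[OF refl])
    fix t assume t: "t \<in> reps"
    then have eq: "{x\<in>reps. x\<^sup>2 mod int p = t} = {x\<in>reps. [x\<^sup>2 = t] (mod int p)}"
      by (auto simp: cong_def)
    have "(\<Sum>x\<in>{x\<in>reps. [x\<^sup>2 = t] (mod int p)}. f (x\<^sup>2)) = (\<Sum>x\<in>{x\<in>reps. [x\<^sup>2 = t] (mod int p)}. f t)"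
      by (intro sum.cong per) auto
    also have "\<dots> = (1 + chi t) * f t" by (simp only: sum_constant card_square_roots of_int_of_nat_eq of_nat_id)
    finally show "(\<Sum>x\<in>{x\<in>reps. x\<^sup>2 mod int p = t}. f (x\<^sup>2)) = (1 + chi t) * f t"
      by (simp only: eq)
  qed
  finally show ?thesis .
qed

lemma sum_chi: "(\<Sum>t\<in>reps. chi t) = 0"
  using sum_square_arg[of "\<lambda>_. 1"] by (simp add: sum.distrib)

lemma sum_chi_affine: "\<not> int p dvd u \<Longrightarrow> (\<Sum>x\<in>reps. chi (u * x + v)) = 0"
  using sum_affine[of chi u v] sum_chi chi_cong by simp

lemma sum_indicator_coprime:
  "(\<Sum>B\<in>reps. if int p dvd B then c else d) = c + (int p - 1) * d"
proof -
  have R: "reps = insert 0 {1..<int p}" using p_gt_2 by auto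
  have "(\<Sum>B\<in>{1..<int p}. if int p dvd B then c else d) = (\<Sum>B\<in>{1..<int p}. d)"
    by (intro sum.cong refl) (auto dest: zdvd_imp_le)
  then show ?thesis unfolding R using p_gt_2 by (simp add: of_nat_diff)
qed

text \<open>The substitution \<open>t \<mapsto> B t\<close> shows that the sum does not depend on \<open>B \<noteq> 0\<close>, and the sum
  over all \<open>B\<close> vanishes.\<close>
lemma sum_chi_mult_affine:
  assumes A: "\<not> int p dvd A" and B: "\<not> int p dvd B"
  shows "(\<Sum>t\<in>reps. chi t * chi (A * t + B)) = - chi A"
proof -
  define T where "T B = (\<Sum>t\<in>reps. chi t * chi (A * t + B))" for B
  have T_eq: "T B = T 1" if "\<not> int p dvd B" for B
  proof -
    have "T B = (\<Sum>t\<in>reps. chi (B * t + 0) * chi (A * (B * t + 0) + B))"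
      unfolding T_def
      by (rule sum_affine[symmetric, where f = "\<lambda>t. chi t * chi (A * t + B)"])
        (use that in \<open>auto intro!: arg_cong2[where f = "(*)"] chi_cong cong_add cong_mult\<close>)
    also have "\<dots> = (\<Sum>t\<in>reps. chi (B\<^sup>2) * (chi t * chi (A * t + 1)))"
    proof (rule sum.cong[OF refl])
      fix t
      have "chi (A * (B * t + 0) + B) = chi (B * (A * t + 1))" by (simp add: algebra_simps)
      then show "chi (B * t + 0) * chi (A * (B * t + 0) + B) = chi (B\<^sup>2) * (chi t * chi (A * t + 1))"
        by (simp add: chi_mult power2_eq_square)
    qed
    also have "\<dots> = T 1" using that by (simp add: T_def chi_square)
    finally show ?thesis .
  qed
  have T0: "T B = (int p - 1) * chi A" if "int p dvd B" for B
  proof -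
    have "T B = (\<Sum>t\<in>reps. if int p dvd t then 0 else chi A)"
      unfolding T_def
    proof (rule sum.cong[OF refl])
      fix t
      have "chi (A * t + B) = chi (A * t)" using that by (intro chi_cong) (simp add: cong_iff_dvd_diff)
      then have "chi t * chi (A * t + B) = chi A * chi (t\<^sup>2)" by (simp add: chi_mult power2_eq_square)
      then show "chi t * chi (A * t + B) = (if int p dvd t then 0 else chi A)"
        using chi_eq_0_iff[of t] chi_square[of t] by (cases "int p dvd t") simp_all
    qed
    then show ?thesis by (simp add: sum_indicator_coprime)
  qed
  have "(\<Sum>B\<in>reps. T B) = (\<Sum>t\<in>reps. chi t * (\<Sum>B\<in>reps. chi (1 * B + A * t)))"
    unfolding T_def by (subst sum.swap) (simp add: sum_distrib_left add.commute)
  also have "\<dots> = 0" using sum_chi_affine[of 1] p_gt_2 by simp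
  finally have "(\<Sum>B\<in>reps. T B) = 0" .
  moreover have "(\<Sum>B\<in>reps. T B) = (\<Sum>B\<in>reps. if int p dvd B then (int p - 1) * chi A else T 1)"
    by (rule sum.cong) (auto simp: T0 intro: T_eq)
  ultimately have "(int p - 1) * (chi A + T 1) = 0"
    by (simp add: sum_indicator_coprime algebra_simps)
  then have "T 1 = - chi A" using p_gt_2 by auto
  then show ?thesis using T_eq[OF B] by (simp add: T_def)
qed

text \<open>Substituting \<open>t = x^2\<close> leaves a linear sum, which vanishes, and the sum of
  \<open>sum_chi_mult_affine\<close>.\<close>

lemma sum_chi_quadratic:
  assumes A: "\<not> int p dvd A" and B: "\<not> int p dvd B"
  shows "(\<Sum>x\<in>reps. chi (A * x\<^sup>2 + B)) = - chi A"
proof -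
  have "(\<Sum>x\<in>reps. chi (A * x\<^sup>2 + B)) = (\<Sum>t\<in>reps. (1 + chi t) * chi (A * t + B))"
    by (rule sum_square_arg[where f = "\<lambda>t. chi (A * t + B)"]) (intro chi_cong cong_add cong_mult; simp)
  also have "\<dots> = (\<Sum>t\<in>reps. chi (A * t + B)) + (\<Sum>t\<in>reps. chi t * chi (A * t + B))"
    by (simp add: distrib_right sum.distrib)
  finally show ?thesis using sum_chi_affine[OF A] sum_chi_mult_affine[OF A B] by simp
qed

text \<open>If \<open>-1\<close> is a non-residue, squaring permutes the squares, so \<open>x\<^sup>4\<close> can be replaced by \<open>x\<^sup>2\<close>.\<close>
lemma sum_chi_quartic:
  assumes neg: "chi (-1) = -1" and A: "\<not> int p dvd A" and B: "\<not> int p dvd B"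
  shows "(\<Sum>x\<in>reps. chi (A * (x\<^sup>2)\<^sup>2 + B)) = - chi A"
proof -
  let ?g = "\<lambda>t. chi (A * t\<^sup>2 + B)"
  have per: "[x = y] (mod int p) \<Longrightarrow> ?g x = ?g y" for x y
    by (intro chi_cong cong_add cong_mult cong_pow; simp)
  \<comment> \<open>The substitution \<open>t \<mapsto> - t\<close> flips \<open>chi t\<close> and
    fixes \<open>?g t\<close>, so the sum equals its own negative.\<close>
  have "(\<Sum>t\<in>reps. chi t * ?g t) = (\<Sum>t\<in>reps. chi ((-1) * t + 0) * ?g ((-1) * t + 0))"
    by (rule sum_affine[symmetric, where f = "\<lambda>t. chi t * ?g t"])
      (use per chi_cong prime_int_p in \<open>auto simp: not_prime_unit intro!: arg_cong2[where f = "(*)"]\<close>)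
  also have "\<dots> = (\<Sum>t\<in>reps. - (chi t * ?g t))"
  proof (rule sum.cong[OF refl])
    fix t
    have "chi (- t) = - chi t" using chi_mult[of "-1" t] neg by simp
    then show "chi ((-1) * t + 0) * ?g ((-1) * t + 0) = - (chi t * ?g t)" by simp
  qed
  also have "\<dots> = - (\<Sum>t\<in>reps. chi t * ?g t)" by (rule sum_negf)
  finally have "(\<Sum>t\<in>reps. chi t * ?g t) = 0" by simp
  moreover have "(\<Sum>x\<in>reps. ?g (x\<^sup>2)) = (\<Sum>t\<in>reps. (1 + chi t) * ?g t)"
    by (rule sum_square_arg[where f = ?g]) (rule per)
  ultimately show ?thesis using sum_chi_quadratic[OF A B] by (simp add: distrib_right sum.distrib)
qed

text \<open>Since \<open>A * (A * x^2 + B) = (A * x)^2 + A * B\<close>, the zeros correspond to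
  square roots of \<open>- (A * B)\<close>.\<close>

lemma count_quadratic_zeros:
  assumes A: "\<not> int p dvd A"
  shows "(\<Sum>x\<in>reps. if int p dvd A * x\<^sup>2 + B then 1 else 0) = 1 + chi (- (A * B))"
proof -
  let ?f = "\<lambda>y::int. if [y\<^sup>2 = - (A * B)] (mod int p) then 1 else (0::int)"
  have "(\<Sum>x\<in>reps. if int p dvd A * x\<^sup>2 + B then 1 else 0) = (\<Sum>x\<in>reps. ?f (A * x + 0))"
  proof (rule sum.cong[OF refl])
    fix x
    have "(A * x)\<^sup>2 - (- (A * B)) = A * (A * x\<^sup>2 + B)" by (simp add: power2_eq_square algebra_simps)
    then have "[(A * x)\<^sup>2 = - (A * B)] (mod int p) \<longleftrightarrow> int p dvd A * x\<^sup>2 + B"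
      using A prime_int_p by (simp add: cong_iff_dvd_diff prime_dvd_mult_iff)
    then show "(if int p dvd A * x\<^sup>2 + B then 1 else 0) = ?f (A * x + 0)" by simp
  qed
  also have "\<dots> = (\<Sum>x\<in>reps. ?f x)"
    by (rule sum_affine[OF _ A]) (meson cong_pow cong_sym cong_trans)
  also have "\<dots> = 1 + chi (- (A * B))"
    by (simp add: card_square_roots[symmetric] sum.If_cases Int_def)
  finally show ?thesis .
qed


section \<open>Simultaneous non-residues\<close>

text \<open>Otherwise \<open>(1 - f x) * (1 - g x)\<close> is nonzero only where \<open>f\<close> or
  \<open>g\<close> vanishes, and is at most 2 per zero. As \<open>chi\<close> is odd, there are two
  zeros in total, so the sum is at most 4; but it equals \<open>p + 2 * chi 5 - 1\<close>, which
  exceeds 4.\<close>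

lemma exists_both_nonresidues_3_mod_4:
  assumes neg: "chi (-1) = -1" and p: "p > 7" and D: "\<not> int p dvd D"
  shows "\<exists>x. chi (5 * x\<^sup>2 + 4 * D) = -1 \<and> chi (5 * x\<^sup>2 - 4 * D) = -1"
proof (rule ccontr)
  assume none: "\<not> ?thesis"
  define f where "f x = chi (5 * x\<^sup>2 + 4 * D)" for x
  define g where "g x = chi (5 * x\<^sup>2 + - 4 * D)" for x
  have p5: "\<not> int p dvd 5" using p by (auto dest: zdvd_imp_le)
  have p4: "\<not> int p dvd 4" using p by (auto dest: zdvd_imp_le)
  have D4: "\<not> int p dvd 4 * D" "\<not> int p dvd - 4 * D"
    using p4 D prime_int_p by (auto simp: prime_dvd_mult_iff)
  have p25: "\<not> int p dvd 5 * 5" and D16: "\<not> int p dvd - (4 * D)\<^sup>2"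
    using p5 D4(1) prime_int_p prime_dvd_mult_iff[of "int p" 5 5] prime_dvd_power[of "int p" "4 * D" 2]
    unfolding dvd_minus_iff by blast+
  \<comment> \<open>The product is \<open>chi\<close> of a quartic, to which
    \<open>sum_chi_quartic\<close> applies because \<open>chi (-1) = -1\<close>.\<close>
  have fg: "f x * g x = chi (5 * 5 * (x\<^sup>2)\<^sup>2 + - (4 * D)\<^sup>2)" for x
    unfolding f_def g_def chi_mult[symmetric] by (simp add: power2_eq_square algebra_simps)
  have chi25: "chi (5 * 5) = 1" using chi_square[OF p5] by (simp add: power2_eq_square)
  have sum_fg: "(\<Sum>x\<in>reps. f x * g x) = -1"
    using sum_chi_quartic[OF neg p25 D16] by (simp only: fg chi25)
  have "(\<Sum>x\<in>reps. (1 - f x) * (1 - g x)) = (\<Sum>x\<in>reps. 1 - f x - g x + f x * g x)"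
    by (rule sum.cong) (auto simp: algebra_simps)
  also have "\<dots> = int p + 2 * chi 5 - 1"
    using sum_chi_quadratic[OF p5 D4(1)] sum_chi_quadratic[OF p5 D4(2)]
    by (simp add: sum.distrib sum_subtractf sum_fg f_def[symmetric] g_def[symmetric] del: mult_minus_left)
  finally have lower: "(\<Sum>x\<in>reps. (1 - f x) * (1 - g x)) = int p + 2 * chi 5 - 1" .
  have "(\<Sum>x\<in>reps. (1 - f x) * (1 - g x)) \<le>
     (\<Sum>x\<in>reps. 2 * (if int p dvd 5 * x\<^sup>2 + 4 * D then 1 else 0) + 2 * (if int p dvd 5 * x\<^sup>2 + - 4 * D then 1 else 0))"
  proof (rule sum_mono)
    fix x
    have "\<not> (f x = -1 \<and> g x = -1)" using none by (auto simp: f_def g_def)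
    moreover have "f x = 0 \<longleftrightarrow> int p dvd 5 * x\<^sup>2 + 4 * D" "g x = 0 \<longleftrightarrow> int p dvd 5 * x\<^sup>2 + - 4 * D"
      unfolding f_def g_def by (rule chi_eq_0_iff)+
    moreover have "f x = -1 \<or> f x = 0 \<or> f x = 1" "g x = -1 \<or> g x = 0 \<or> g x = 1"
      unfolding f_def g_def by (rule chi_cases)+
    ultimately show "(1 - f x) * (1 - g x) \<le> 2 * (if int p dvd 5 * x\<^sup>2 + 4 * D then 1 else 0)
        + 2 * (if int p dvd 5 * x\<^sup>2 + - 4 * D then 1 else 0)"
      by auto
  qed
  also have "\<dots> = 2 * (1 + chi (- (5 * (4 * D)))) + 2 * (1 + chi (- (5 * (- 4 * D))))"
    by (simp only: sum.distrib sum_distrib_left[symmetric] count_quadratic_zeros[OF p5])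
  also have "\<dots> = 4"
    using chi_mult[of "-1" "5 * (4 * D)"] neg by simp
  finally have "int p + 2 * chi 5 - 1 \<le> 4" using lower by simp
  moreover have "chi 5 \<ge> -1" using chi_cases[of 5] by auto
  ultimately show False using p by simp
qed

text \<open>Here \<open>chi\<close> is even and \<open>D\<close> turns out to be a square. Then
  \<open>f + g\<close> is 2 at the three points 0 and the two roots of \<open>D\<close>, and
  elsewhere at least minus the number of zeros. So the sum is at least \<open>4 - 2 * chi 5\<close>,
  while its value is \<open>- 2 * chi 5\<close>.\<close>

lemma exists_both_nonresidues_1_mod_4:
  assumes pos: "chi (-1) = 1" and p: "p > 7" and D: "\<not> int p dvd D"
  shows "\<exists>x. chi (5 * x\<^sup>2 + 4 * D) = -1 \<and> chi (5 * x\<^sup>2 - 4 * D) = -1"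
proof (rule ccontr)
  assume none: "\<not> ?thesis"
  define f where "f x = chi (5 * x\<^sup>2 + 4 * D)" for x
  define g where "g x = chi (5 * x\<^sup>2 + - 4 * D)" for x
  have p5: "\<not> int p dvd 5" using p by (auto dest: zdvd_imp_le)
  have p3: "\<not> int p dvd 3" using p by (auto dest: zdvd_imp_le)
  have p4: "\<not> int p dvd 4" using p by (auto dest: zdvd_imp_le)
  have D4: "\<not> int p dvd 4 * D" "\<not> int p dvd - 4 * D"
    using p4 D prime_int_p by (auto simp: prime_dvd_mult_iff)
  have chi4: "chi 4 = 1" using chi_square[OF not_dvd_numeral_2] by simp
  have chi9: "chi 9 = 1" using chi_square[OF p3] by simp
  have chi_neg: "chi (- a) = chi a" for a using chi_mult[of "-1" a] pos by simp
  \<comment> \<open>At \<open>x = 0\<close> both symbols equal \<open>chi D\<close>, which therefore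
    cannot be -1.\<close>
  have chi_D: "chi D = 1"
    using none chi_cases[of D] chi_eq_0_iff[of D] D chi_neg[of "4 * D"] chi4 chi_mult[of 4 D]
    by (metis add_0 diff_0 mult_zero_right mult_1 power_zero_numeral)
  then obtain s0 where s0: "[s0\<^sup>2 = D] (mod int p)" using chi_eq_1_iff by blast
  define s where "s = s0 mod int p"
  have p0: "int p > 0" using p by simp
  have s: "[s\<^sup>2 = D] (mod int p)" using s0 by (simp add: s_def cong_def power_mod)
  have sR: "0 \<le> s" "s < int p" using p0 by (auto simp: s_def)
  have "\<not> int p dvd s\<^sup>2" using s D by (simp add: cong_dvd_iff)
  then have "s \<noteq> 0" by auto
  have "odd (int p)" using prime_p p_gt_2 prime_odd_nat by simp
  then have ne: "s \<noteq> int p - s" by presburger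
  have "(int p - s)\<^sup>2 = s\<^sup>2 + int p * (int p - 2 * s)" by (simp add: power2_eq_square algebra_simps)
  then have s': "[(int p - s)\<^sup>2 = D] (mod int p)" using s by (simp add: cong_def)
  let ?E = "{0, s, int p - s}"
  have card_E: "card ?E = 3" using \<open>s \<noteq> 0\<close> ne sR by auto
  have E_reps: "?E \<subseteq> reps" using sR \<open>s \<noteq> 0\<close> by auto
  \<comment> \<open>The two arguments are congruent to \<open>9 * D\<close> and
    \<open>D\<close>.\<close>
  have at_root: "f z + g z = 2" if "[z\<^sup>2 = D] (mod int p)" for z
  proof -
    have "f z = chi (5 * D + 4 * D)" "g z = chi (5 * D + - 4 * D)"
      unfolding f_def g_def by (intro chi_cong cong_add cong_mult cong_refl that)+
    then show ?thesis using chi_mult[of 9 D] chi9 chi_D by simp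
  qed
  moreover have "f 0 + g 0 = 2"
    using chi_mult[of 4 D] chi4 chi_D chi_neg[of "4 * D"] by (simp add: f_def g_def)
  ultimately have at_E: "f z + g z = 2" if "z \<in> ?E" for z using that s s' by blast
  have "(\<Sum>x\<in>reps. 2 * (if x \<in> ?E then 1 else 0) - (if int p dvd 5 * x\<^sup>2 + 4 * D then 1 else 0)
      - (if int p dvd 5 * x\<^sup>2 + - 4 * D then 1 else 0)) \<le> (\<Sum>x\<in>reps. f x + g x)"
  proof (rule sum_mono)
    fix x
    have "\<not> (f x = -1 \<and> g x = -1)" using none by (auto simp: f_def g_def)
    moreover have "f x = 0 \<longleftrightarrow> int p dvd 5 * x\<^sup>2 + 4 * D" "g x = 0 \<longleftrightarrow> int p dvd 5 * x\<^sup>2 + - 4 * D"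
      unfolding f_def g_def by (rule chi_eq_0_iff)+
    moreover have "f x = -1 \<or> f x = 0 \<or> f x = 1" "g x = -1 \<or> g x = 0 \<or> g x = 1"
      unfolding f_def g_def by (rule chi_cases)+
    ultimately show "2 * (if x \<in> ?E then 1 else 0) - (if int p dvd 5 * x\<^sup>2 + 4 * D then 1 else 0)
      - (if int p dvd 5 * x\<^sup>2 + - 4 * D then 1 else 0) \<le> f x + g x"
      using at_E[of x] by (cases "x \<in> ?E") auto
  qed
  also have "\<dots> = - 2 * chi 5"
    using sum_chi_quadratic[OF p5 D4(1)] sum_chi_quadratic[OF p5 D4(2)]
    by (simp add: sum.distrib f_def g_def)
  finally have upper: "(\<Sum>x\<in>reps. 2 * (if x \<in> ?E then 1 else 0) - (if int p dvd 5 * x\<^sup>2 + 4 * D then 1 else 0)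
      - (if int p dvd 5 * x\<^sup>2 + - 4 * D then 1 else 0)) \<le> - 2 * chi 5" .
  have "(\<Sum>x\<in>reps. if x \<in> ?E then 1 else 0) = (3::int)"
    using card_E E_reps by (simp only: sum.inter_restrict[symmetric] finite_atLeastLessThan_int inf.absorb2 sum_constant)
  then have "2 * 3 - (1 + chi (- (5 * (4 * D)))) - (1 + chi (- (5 * (- 4 * D)))) \<le> - 2 * chi 5"
    using upper by (simp only: sum_subtractf sum_distrib_left[symmetric] count_quadratic_zeros[OF p5])
  moreover have "chi (- (5 * (4 * D))) = chi 5" "chi (- (5 * (- 4 * D))) = chi 5"
    using chi_neg[of "5 * (4 * D)"] chi_mult[of 5 "4 * D"] chi_mult[of 4 D] chi4 chi_D by simp_all
  ultimately show False by simp
qed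

lemma exists_both_nonresidues:
  assumes "p > 7" "\<not> int p dvd D"
  shows "\<exists>x. chi (5 * x\<^sup>2 + 4 * D) = -1 \<and> chi (5 * x\<^sup>2 - 4 * D) = -1"
proof (cases "even ((p - 1) div 2)")
  case True
  then show ?thesis using exists_both_nonresidues_1_mod_4 assms by (simp add: chi_minus_1)
next
  case False
  then show ?thesis using exists_both_nonresidues_3_mod_4 assms by (simp add: chi_minus_1)
qed

end

section \<open>Excluded moduli\<close>

text \<open>The value \<open>b - a\<close> at index 0 makes the recurrence hold from there on, so
  inductions can start at 0.\<close>

lemma gib_Suc_Suc: "gib a b (Suc (Suc n)) = gib a b n + gib a b (Suc n)"
  by (cases n) auto

text \<open>The form changes sign under \<open>(x, y) \<mapsto> (y, x + y)\<close>.\<close>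

lemma gib_form:
  "(gib a b n)\<^sup>2 + gib a b n * gib a b (Suc n) - (gib a b (Suc n))\<^sup>2 = (-1) ^ Suc n * (a\<^sup>2 + a * b - b\<^sup>2)"
proof (induction n)
  case 0
  have "(b - a)\<^sup>2 + (b - a) * a - a\<^sup>2 = - (a\<^sup>2 + a * b - b\<^sup>2)"
    by (simp add: power2_eq_square algebra_simps)
  then show ?case by simp
next
  case (Suc n)
  have eq: "y\<^sup>2 + y * (x + y) - (x + y)\<^sup>2 = - (x\<^sup>2 + x * y - y\<^sup>2)" for x y :: int
    by (simp add: power2_eq_square algebra_simps)
  show ?case unfolding gib_Suc_Suc[of a b n] eq Suc.IH by simp
qed

lemma gcd_gib: "gcd (gib a b n) (gib a b (Suc n)) = gcd a b"
proof (induction n)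
  case 0
  have "gcd (b - a) a = gcd b a" by (metis gcd_diff1)
  then show ?case by (simp add: gcd.commute)
next
  case (Suc n)
  then show ?case
    by (simp only: gib_Suc_Suc[of a b n] gcd_add2 add.commute[of "gib a b n"] gcd.commute[of "gib a b n"])
qed

text \<open>Take for \<open>y\<close> the successor of a term congruent to \<open>x\<close>; the
  parity of the index decides the sign.\<close>

lemma complete_mod_imp_form:
  assumes "complete_mod a b m"
  obtains y where "m dvd y\<^sup>2 - x * y - x\<^sup>2 - (a\<^sup>2 + a * b - b\<^sup>2) \<or> m dvd y\<^sup>2 - x * y - x\<^sup>2 + (a\<^sup>2 + a * b - b\<^sup>2)"
proof -
  obtain n where "[gib a b n = x] (mod m)" using assms unfolding complete_mod_def by blast
  then obtain k where k: "x = gib a b n + m * k" by (metis cong_iff_lin)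
  let ?y = "gib a b (Suc n)" and ?D = "a\<^sup>2 + a * b - b\<^sup>2"
  have "?y\<^sup>2 - x * ?y - x\<^sup>2 = - ((gib a b n)\<^sup>2 + gib a b n * ?y - ?y\<^sup>2) - m * (k * ?y + 2 * k * gib a b n + m * k\<^sup>2)"
    unfolding k by (simp add: power2_eq_square algebra_simps)
  also have "\<dots> = (-1) ^ n * ?D - m * (k * ?y + 2 * k * gib a b n + m * k\<^sup>2)"
    by (simp only: gib_form) simp
  finally have *: "?y\<^sup>2 - x * ?y - x\<^sup>2 = (-1) ^ n * ?D - m * (k * ?y + 2 * k * gib a b n + m * k\<^sup>2)" .
  show ?thesis by (rule that[of ?y], unfold *) (cases "even n"; simp)
qed

text \<open>Used both ways: an incomplete modulus excludes its multiples, and a complete one settles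
  its divisors.\<close>

lemma complete_mod_dvd:
  assumes "complete_mod a b m" "d dvd m"
  shows "complete_mod a b d"
  unfolding complete_mod_def
proof
  fix r
  obtain n where "n \<ge> 1" "[gib a b n = r] (mod m)" using assms(1) unfolding complete_mod_def by blast
  then show "\<exists>n\<ge>1. [gib a b n = r] (mod d)" using cong_dvd_modulus[OF _ assms(2)] by blast
qed

lemma prime_not_dvd_both:
  fixes a b p :: int
  assumes "gcd a b = 1" "prime p"
  shows "\<not> (p dvd a \<and> p dvd b)"
  using gcd_greatest[of p a b] assms not_prime_unit by auto

text \<open>If \<open>p\<close> divided a term, the form would make it divide the square of the next
  one, against coprimality of neighbours.\<close>

lemma not_complete_mod_if_dvd_form:
  fixes p :: int
  assumes "gcd a b = 1" "prime p" "p dvd a\<^sup>2 + a * b - b\<^sup>2"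
  shows "\<not> complete_mod a b p"
proof
  assume c: "complete_mod a b p"
  obtain n where n: "[gib a b n = 0] (mod p)" using c unfolding complete_mod_def by blast
  have "p dvd gib a b n" using n by (simp add: cong_0_iff)
  moreover have "p dvd gib a b (Suc n)"
  proof -
    have "(gib a b (Suc n))\<^sup>2 = gib a b n * (gib a b n + gib a b (Suc n)) - (-1) ^ Suc n * (a\<^sup>2 + a * b - b\<^sup>2)"
      unfolding gib_form[symmetric] by (simp add: power2_eq_square algebra_simps)
    then have "p dvd (gib a b (Suc n))\<^sup>2"
      using \<open>p dvd gib a b n\<close> assms(3) by (simp only: dvd_diff dvd_mult dvd_mult2)
    then show ?thesis using assms(2) prime_dvd_power by blast
  qed
  ultimately show False
    using prime_not_dvd_both[of "gib a b n" "gib a b (Suc n)" p] assms(1,2) gcd_gib[of a b n] by simp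
qed

text \<open>Completing the square in the form turns a hit of \<open>x\<close> into a square root of
  \<open>5 * x^2 + 4 * D\<close> or \<open>5 * x^2 - 4 * D\<close>.\<close>

lemma not_complete_mod_prime:
  assumes "gcd a b = 1" "prime p" "p > 7"
  shows "\<not> complete_mod a b (int p)"
proof
  assume c: "complete_mod a b (int p)"
  let ?D = "a\<^sup>2 + a * b - b\<^sup>2"
  have nd: "\<not> int p dvd ?D" using not_complete_mod_if_dvd_form[OF assms(1), of "int p"] c assms(2) by (simp only: prime_nat_int_transfer) blast
  interpret odd_prime p using assms by unfold_locales auto
  obtain x where x: "chi (5 * x\<^sup>2 + 4 * ?D) = -1" "chi (5 * x\<^sup>2 - 4 * ?D) = -1"
    using exists_both_nonresidues[OF assms(3) nd] by blast
  have nsq: "\<not> [z\<^sup>2 = w] (mod int p)" if "chi w = -1" for z w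
    using that by (auto simp: Legendre_def QuadRes_def split: if_splits)
  obtain y where y: "int p dvd y\<^sup>2 - x * y - x\<^sup>2 - ?D \<or> int p dvd y\<^sup>2 - x * y - x\<^sup>2 + ?D"
    using complete_mod_imp_form[OF c] .
  have eq: "(2 * y - x)\<^sup>2 - (5 * x\<^sup>2 + 4 * ?D) = 4 * (y\<^sup>2 - x * y - x\<^sup>2 - ?D)"
    "(2 * y - x)\<^sup>2 - (5 * x\<^sup>2 - 4 * ?D) = 4 * (y\<^sup>2 - x * y - x\<^sup>2 + ?D)"
    by (simp_all add: power2_eq_square algebra_simps)
  have "\<not> int p dvd 4 * (y\<^sup>2 - x * y - x\<^sup>2 - ?D)" "\<not> int p dvd 4 * (y\<^sup>2 - x * y - x\<^sup>2 + ?D)"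
    unfolding eq[symmetric] cong_iff_dvd_diff[symmetric] by (intro nsq x)+
  then show False using y dvd_mult[of "int p" _ 4] by blast
qed

text \<open>Hypothesis \<open>all\<close> says that the form is anisotropic modulo \<open>p\<close>;
  it ranges over a list so that it can be evaluated.\<close>

lemma prime_not_dvd_form:
  fixes p :: int
  assumes "gcd a b = 1" "prime p"
    and all: "\<forall>x\<in>set [0..p - 1]. \<forall>y\<in>set [0..p - 1]. (x * x + x * y - y * y) mod p = 0 \<longrightarrow> x = 0 \<and> y = 0"
  shows "\<not> p dvd a\<^sup>2 + a * b - b\<^sup>2"
proof
  assume "p dvd a\<^sup>2 + a * b - b\<^sup>2"
  then have "(a * a + a * b - b * b) mod p = 0" by (simp add: power2_eq_square)
  moreover have "[a mod p * (a mod p) + a mod p * (b mod p) - b mod p * (b mod p) = a * a + a * b - b * b] (mod p)"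
    by (intro cong_add cong_diff cong_mult) simp_all
  ultimately have form_0: "(a mod p * (a mod p) + a mod p * (b mod p) - b mod p * (b mod p)) mod p = 0"
    unfolding cong_def by simp
  have "p > 0" using assms(2) prime_gt_0_int by blast
  then have "a mod p \<in> set [0..p - 1]" "b mod p \<in> set [0..p - 1]" by simp_all
  then have "a mod p = 0 \<and> b mod p = 0" by (rule all[rule_format, OF _ _ form_0])
  then show False using prime_not_dvd_both[OF assms(1,2)] by (simp add: dvd_eq_mod_eq_0)
qed

text \<open>The form, of discriminant 5, is irreducible modulo 2, 3 and 7.\<close>

lemma coprime_form:
  fixes a b :: int
  assumes "gcd a b = 1"
  shows "coprime (a\<^sup>2 + a * b - b\<^sup>2) 2" "coprime (a\<^sup>2 + a * b - b\<^sup>2) 3" "coprime (a\<^sup>2 + a * b - b\<^sup>2) 7"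
proof -
  have *: "coprime (a\<^sup>2 + a * b - b\<^sup>2) p"
    if "prime p" "\<forall>x\<in>set [0..p - 1]. \<forall>y\<in>set [0..p - 1]. (x * x + x * y - y * y) mod p = 0 \<longrightarrow> x = 0 \<and> y = 0" for p
    using prime_imp_coprime[OF that(1) prime_not_dvd_form[OF assms that]] by (simp add: coprime_commute)
  show "coprime (a\<^sup>2 + a * b - b\<^sup>2) 2" by (rule *, simp) code_simp
  show "coprime (a\<^sup>2 + a * b - b\<^sup>2) 3" by (rule *, simp) code_simp
  show "coprime (a\<^sup>2 + a * b - b\<^sup>2) 7" by (rule *, simp) code_simp
qed

section \<open>Composite moduli\<close>

text \<open>Only the residue of the form value matters, so a search over units \<open>D\<close>
  modulo \<open>m\<close>, with a missed \<open>x\<close> for each, suffices.\<close>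

lemma not_complete_mod_if_form_misses:
  assumes "coprime (a\<^sup>2 + a * b - b\<^sup>2) m" and m: "m > 0"
    and all: "\<forall>D\<in>set [0..m - 1]. gcd D m = 1 \<longrightarrow> (\<exists>x\<in>set [0..m - 1]. \<forall>y\<in>set [0..m - 1].
      (y * y - x * y - x * x - D) mod m \<noteq> 0 \<and> (y * y - x * y - x * x + D) mod m \<noteq> 0)"
  shows "\<not> complete_mod a b m"
proof
  assume c: "complete_mod a b m"
  let ?D = "a\<^sup>2 + a * b - b\<^sup>2"
  have "gcd (?D mod m) m = 1" using assms(1) by (simp add: coprime_iff_gcd_eq_1 gcd.commute gcd_red_int[symmetric])
  then obtain x where x: "\<And>y. y \<in> set [0..m - 1] \<Longrightarrow>
      (y * y - x * y - x * x - ?D mod m) mod m \<noteq> 0 \<and> (y * y - x * y - x * x + ?D mod m) mod m \<noteq> 0"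
    using all m by (metis atLeastAtMost_iff pos_mod_bound pos_mod_sign set_upto zle_diff1_eq)
  obtain y where "m dvd y\<^sup>2 - x * y - x\<^sup>2 - ?D \<or> m dvd y\<^sup>2 - x * y - x\<^sup>2 + ?D"
    using complete_mod_imp_form[OF c] .
  then have "(y * y - x * y - x * x - ?D) mod m = 0 \<or> (y * y - x * y - x * x + ?D) mod m = 0"
    by (simp add: power2_eq_square dvd_eq_mod_eq_0)
  moreover have "[y mod m * (y mod m) - x * (y mod m) - x * x - ?D mod m = y * y - x * y - x * x - ?D] (mod m)"
    "[y mod m * (y mod m) - x * (y mod m) - x * x + ?D mod m = y * y - x * y - x * x + ?D] (mod m)"
    by (intro cong_add cong_diff cong_mult cong_refl; simp)+
  moreover have "y mod m \<in> set [0..m - 1]" using m by simp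
  ultimately show False using x[of "y mod m"] unfolding cong_def by metis
qed

lemma not_complete_mod_8: "gcd a b = 1 \<Longrightarrow> \<not> complete_mod a b 8"
  by (rule not_complete_mod_if_form_misses)
    (use coprime_form[of a b] in \<open>simp add: coprime_mult_right_iff[of _ 2 "2 * 2", simplified] coprime_mult_right_iff[of _ 2 2, simplified]\<close>, simp, code_simp)

lemma not_complete_mod_12: "gcd a b = 1 \<Longrightarrow> \<not> complete_mod a b 12"
  by (rule not_complete_mod_if_form_misses)
    (use coprime_form[of a b] in \<open>simp add: coprime_mult_right_iff[of _ 3 "2 * 2", simplified] coprime_mult_right_iff[of _ 2 2, simplified]\<close>, simp, code_simp)

lemma not_complete_mod_21: "gcd a b = 1 \<Longrightarrow> \<not> complete_mod a b 21"
  by (rule not_complete_mod_if_form_misses)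
    (use coprime_form[of a b] in \<open>simp add: coprime_mult_right_iff[of _ 3 7, simplified]\<close>, simp, code_simp)

lemma not_complete_mod_28: "gcd a b = 1 \<Longrightarrow> \<not> complete_mod a b 28"
  by (rule not_complete_mod_if_form_misses)
    (use coprime_form[of a b] in \<open>simp add: coprime_mult_right_iff[of _ 7 "2 * 2", simplified] coprime_mult_right_iff[of _ 2 2, simplified]\<close>, simp, code_simp)

lemma not_complete_mod_49: "gcd a b = 1 \<Longrightarrow> \<not> complete_mod a b 49"
  by (rule not_complete_mod_if_form_misses)
    (use coprime_form[of a b] in \<open>simp add: coprime_mult_right_iff[of _ 7 7, simplified]\<close>, simp, code_simp)

text \<open>Terms divisible by 9 are exactly 12 indices apart, so all of them have the same parity.\<close>
lemma gib_multiples_of_9_parity: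
  assumes gcd: "gcd a b = 1" and "9 dvd gib a b n" "9 dvd gib a b (n + d)"
  shows "even (gib a b n) \<longleftrightarrow> even (gib a b (n + d))"
  using assms(2,3)
proof (induction d arbitrary: n rule: less_induct)
  case (less d)
  define x y where "x = gib a b n" and "y = gib a b (Suc n)"
  \<comment> \<open>The coefficients are consecutive Fibonacci numbers.\<close>
  have small: "gib a b (n + 1) = y" "gib a b (n + 2) = x + y" "gib a b (n + 3) = x + 2 * y"
    "gib a b (n + 4) = 2 * x + 3 * y" "gib a b (n + 5) = 3 * x + 5 * y" "gib a b (n + 6) = 5 * x + 8 * y"
    "gib a b (n + 7) = 8 * x + 13 * y" "gib a b (n + 8) = 13 * x + 21 * y"
    "gib a b (n + 9) = 21 * x + 34 * y" "gib a b (n + 10) = 34 * x + 55 * y"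
    "gib a b (n + 11) = 55 * x + 89 * y" "gib a b (n + 12) = 89 * x + 144 * y"
    by (simp_all add: x_def y_def gib_Suc_Suc eval_nat_numeral)
  have x: "9 dvd x" using less.prems by (simp add: x_def)
  have "prime (3::int)" by simp
  then have "\<not> (3 dvd x \<and> 3 dvd y)"
    using prime_not_dvd_both[of x y 3] gcd gcd_gib[of a b n] by (simp add: x_def y_def)
  then have "\<not> 3 dvd y" using x dvd_trans[of 3 9 x] by simp
  then have "coprime 3 y" by (rule prime_imp_coprime[OF \<open>prime 3\<close>])
  then have "coprime (3 * 3) y" by (simp only: coprime_mult_left_iff)
  \<comment> \<open>As 9 divides \<open>x\<close> and is coprime to \<open>y\<close>, only the
    coefficient \<open>u\<close> counts; the first Fibonacci number divisible by 9 is 144.\<close>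
  then have nd: "\<not> 9 dvd v * x + u * y" if "\<not> 9 dvd u" for u v
    using that x by (simp add: dvd_add_right_iff coprime_dvd_mult_left_iff)
  show ?case
  proof (cases "d < 12")
    case True
    then have "d = 0 \<or> d = 1 \<or> d = 2 \<or> d = 3 \<or> d = 4 \<or> d = 5 \<or> d = 6 \<or> d = 7 \<or> d = 8 \<or> d = 9
      \<or> d = 10 \<or> d = 11" by (auto simp: eval_nat_numeral less_Suc_eq)
    moreover have "\<not> 9 dvd gib a b (n + 1)" "\<not> 9 dvd gib a b (n + 2)" "\<not> 9 dvd gib a b (n + 3)"
      "\<not> 9 dvd gib a b (n + 4)" "\<not> 9 dvd gib a b (n + 5)" "\<not> 9 dvd gib a b (n + 6)"
      "\<not> 9 dvd gib a b (n + 7)" "\<not> 9 dvd gib a b (n + 8)" "\<not> 9 dvd gib a b (n + 9)"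
      "\<not> 9 dvd gib a b (n + 10)" "\<not> 9 dvd gib a b (n + 11)"
      unfolding small
      using nd[of 1 0] nd[of 1 1] nd[of 2 1] nd[of 3 2] nd[of 5 3] nd[of 8 5] nd[of 13 8] nd[of 21 13]
        nd[of 34 21] nd[of 55 34] nd[of 89 55] by simp_all
    ultimately have "d = 0" using less.prems(2) by (elim disjE) simp_all
    then show ?thesis by simp
  next
    case False
    define e where "e = d - 12"
    have e: "e < d" "n + d = n + 12 + e" using False by (simp_all add: e_def)
    \<comment> \<open>In \<open>89 * x + 144 * y\<close>, 89 is odd while 144 is even and a multiple
      of 9.\<close>
    have n12: "9 dvd gib a b (n + 12)" "even (gib a b (n + 12)) \<longleftrightarrow> even x"
      unfolding small using x by simp_all
    have "even (gib a b (n + 12)) \<longleftrightarrow> even (gib a b (n + 12 + e))"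
      using less.prems(2) unfolding e(2) by (rule less.IH[OF e(1) n12(1)])
    then show ?thesis unfolding e(2) using n12(2) unfolding x_def by blast
  qed
qed

text \<open>The residues 0 and 9 are both multiples of 9, but of opposite parity.\<close>

lemma not_complete_mod_18:
  assumes "gcd a b = 1"
  shows "\<not> complete_mod a b 18"
proof
  assume "complete_mod a b 18"
  then obtain i j where "[gib a b i = 0] (mod 18)" "[gib a b j = 9] (mod 18)"
    unfolding complete_mod_def by blast
  moreover have "9 dvd x \<and> even x" if "[x = 0] (mod 18)" for x :: int
    using that unfolding cong_def by presburger
  moreover have "9 dvd x \<and> odd x" if "[x = 9] (mod 18)" for x :: int
    using that unfolding cong_def by simp presburger
  ultimately have ij: "9 dvd gib a b i" "even (gib a b i)" "9 dvd gib a b j" "odd (gib a b j)"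
    by blast+
  show False
  proof (cases "i \<le> j")
    case True
    then show ?thesis using gib_multiples_of_9_parity[OF assms, of i "j - i"] ij by simp
  next
    case False
    then show ?thesis using gib_multiples_of_9_parity[OF assms, of j "i - j"] ij by simp
  qed
qed

section \<open>The shape of the remaining moduli\<close>

text \<open>Excluding 8 and 49 bounds the exponents of 2 and 7; 12, 18, 21 and 28 limit the mixed
  products. The power of 5 stays free.\<close>

lemma seven_smooth_classification:
  fixes m :: int
  assumes m: "m > 0" and primes: "\<And>p::nat. prime p \<Longrightarrow> int p dvd m \<Longrightarrow> p \<le> 7"
    and nd: "\<not> 8 dvd m" "\<not> 12 dvd m" "\<not> 18 dvd m" "\<not> 21 dvd m" "\<not> 28 dvd m" "\<not> 49 dvd m"
  obtains c k where "m = c * 5 ^ k" "c \<in> {1, 2, 4, 6, 7, 14} \<or> (\<exists>j\<ge>1. c = 3 ^ j)"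
proof -
  define k where "k = multiplicity 5 m"
  obtain m1 where m1: "m = 5 ^ k * m1" "\<not> 5 dvd m1"
    using multiplicity_decompose'[of m 5] m unfolding k_def by auto
  define j where "j = multiplicity 3 m1"
  obtain m2 where m2: "m1 = 3 ^ j * m2" "\<not> 3 dvd m2"
    using multiplicity_decompose'[of m1 3] m m1 unfolding j_def by auto
  define i where "i = multiplicity 2 m2"
  obtain m3 where m3: "m2 = 2 ^ i * m3" "\<not> 2 dvd m3"
    using multiplicity_decompose'[of m2 2] m m1 m2 unfolding i_def by auto
  define l where "l = multiplicity 7 m3"
  obtain m4 where m4: "m3 = 7 ^ l * m4" "\<not> 7 dvd m4"
    using multiplicity_decompose'[of m3 7] m m1 m2 m3 unfolding l_def by auto
  have m_eq: "m = 5 ^ k * (3 ^ j * (2 ^ i * (7 ^ l * m4)))"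
    using m1 m2 m3 m4 by simp
  have "m4 > 0" using m unfolding m_eq by (simp add: zero_less_mult_iff)
  have "m4 = 1"
  proof (rule ccontr)
    assume "m4 \<noteq> 1"
    then have "nat m4 \<noteq> 1" using \<open>m4 > 0\<close> by simp
    then obtain p where p: "prime p" "p dvd nat m4" using prime_factor_nat by blast
    then have p4: "int p dvd m4" using \<open>m4 > 0\<close> by (metis int_dvd_int_iff int_nat_eq less_imp_le)
    then have "p \<le> 7" using primes[OF p(1)] unfolding m_eq by (simp add: dvd_mult)
    then have "p = 0 \<or> p = 1 \<or> p = 2 \<or> p = 3 \<or> p = 4 \<or> p = 5 \<or> p = 6 \<or> p = 7" by arith
    then have "p = 2 \<or> p = 3 \<or> p = 5 \<or> p = 7" using p(1) by (elim disjE) simp_all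
    then show False using p4 m1 m2 m3 m4 by (elim disjE) (simp_all add: dvd_mult)
  qed
  then have m_eq: "m = 5 ^ k * 3 ^ j * 2 ^ i * 7 ^ l" using m_eq by simp
  have pw: "q ^ s dvd q ^ t" if "s \<le> t" for q :: int and s t using that by (rule le_imp_power_dvd)
  have "i < 3"
  proof (rule ccontr)
    assume "\<not> i < 3"
    then have "2 ^ 3 dvd m" unfolding m_eq by (intro dvd_mult2 dvd_mult pw) simp
    then show False using nd by simp
  qed
  have "l < 2"
  proof (rule ccontr)
    assume "\<not> l < 2"
    then have "7 ^ 2 dvd m" unfolding m_eq by (intro dvd_mult pw) simp
    then show False using nd by simp
  qed
  have il: "\<not> (i = 2 \<and> l = 1)" using nd(5) unfolding m_eq by auto
  have jl: "\<not> (j \<ge> 1 \<and> l = 1)"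
  proof
    assume "j \<ge> 1 \<and> l = 1"
    then have "3 ^ 1 * 7 ^ 1 dvd 3 ^ j * (2 ^ i * 7 ^ l :: int)" by (intro mult_dvd_mono pw dvd_mult) simp_all
    then have "3 ^ 1 * 7 ^ 1 dvd 5 ^ k * (3 ^ j * (2 ^ i * 7 ^ l :: int))" by (rule dvd_mult)
    then have "21 dvd m" unfolding m_eq mult.assoc by simp
    then show False using nd by simp
  qed
  \<comment> \<open>The instances (1, 2) and (2, 1) for \<open>s\<close> and \<open>t\<close> are
    the moduli 12 and 18.\<close>
  have ji: "\<not> (j \<ge> s \<and> i \<ge> t)" if "\<not> 3 ^ s * 2 ^ t dvd m" for s t
  proof
    assume "j \<ge> s \<and> i \<ge> t"
    then have "3 ^ s * 2 ^ t dvd 3 ^ j * (2 ^ i * 7 ^ l :: int)" by (intro mult_dvd_mono pw dvd_mult2) simp_all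
    then have "3 ^ s * 2 ^ t dvd m" unfolding m_eq mult.assoc by (rule dvd_mult)
    then show False using that by simp
  qed
  have j1: "\<not> (j \<ge> 1 \<and> i \<ge> 2)" and j2: "\<not> (j \<ge> 2 \<and> i \<ge> 1)"
    using ji[of 1 2] ji[of 2 1] nd by simp_all
  let ?c = "3 ^ j * 2 ^ i * 7 ^ l :: int"
  have "m = ?c * 5 ^ k" unfolding m_eq by simp
  moreover have "?c \<in> {1, 2, 4, 6, 7, 14} \<or> (\<exists>j\<ge>1. ?c = 3 ^ j)"
  proof (cases "j = 0")
    case True
    have "i = 0 \<or> i = 1 \<or> i = 2" "l = 0 \<or> l = 1" using \<open>i < 3\<close> \<open>l < 2\<close> by auto
    then show ?thesis using True il by (elim disjE) simp_all
  next
    case False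
    then have "l = 0" using jl \<open>l < 2\<close> by auto
    show ?thesis
    proof (cases "i = 0")
      case True
      then show ?thesis using False \<open>l = 0\<close> by (intro disjI2 exI[of _ j]) simp
    next
      case i: False
      then have "i = 1" "j = 1" using j1 j2 False by auto
      then show ?thesis using \<open>l = 0\<close> by simp
    qed
  qed
  ultimately show ?thesis by (rule that)
qed

lemma complete_mod_classification:
  assumes gcd: "gcd a b = 1" and m: "m > 0" and c: "complete_mod a b m"
  obtains c k where "m = c * 5 ^ k" "c \<in> {1, 2, 4, 6, 7, 14} \<or> (\<exists>j\<ge>1. c = 3 ^ j)"
proof (rule seven_smooth_classification[OF m])
  note dvd = complete_mod_dvd[OF c]
  show "p \<le> 7" if "prime p" "int p dvd m" for p
    using not_complete_mod_prime[OF gcd that(1)] dvd[OF that(2)] by force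
  show "\<not> 8 dvd m" "\<not> 12 dvd m" "\<not> 18 dvd m" "\<not> 21 dvd m" "\<not> 28 dvd m" "\<not> 49 dvd m"
    using dvd not_complete_mod_8[OF gcd] not_complete_mod_12[OF gcd] not_complete_mod_18[OF gcd]
      not_complete_mod_21[OF gcd] not_complete_mod_28[OF gcd] not_complete_mod_49[OF gcd] by blast+
qed (rule that)

section \<open>Lifting completeness\<close>

text \<open>The addition formula: \<open>gib 0 1 k\<close> and \<open>gib 1 1 k\<close> are the
  Fibonacci numbers F(k-1) and F(k), with F(-1) = 1.\<close>

lemma gib_add:
  "gib a b (n + k) = gib 0 1 k * gib a b n + gib 1 1 k * gib a b (Suc n)"
proof (induction k rule: induct_nat_012)
  case (ge2 k)
  have "gib a b (n + Suc (Suc k)) = gib a b (n + k) + gib a b (n + Suc k)"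
    by (simp add: gib_Suc_Suc)
  then show ?case
    unfolding ge2.IH gib_Suc_Suc[of 0 1] gib_Suc_Suc[of 1 1] by (simp add: distrib_right)
qed simp_all

lemma cong_imp_eq_add: "[y = z] (mod q) \<Longrightarrow> \<exists>j. y = z + q * j" for q :: int
  by (drule cong_sym) (simp add: cong_iff_lin)

text \<open>Quantifying over all \<open>a\<close>, \<open>b\<close> makes this a matrix identity;
  \<open>x\<close> and \<open>y\<close> are the coordinates of the correction term in the basis
  consisting of the companion matrix and 1.\<close>

definition gib_shift :: "nat \<Rightarrow> int \<Rightarrow> int \<Rightarrow> int \<Rightarrow> bool" where
  "gib_shift P m x y \<longleftrightarrow>
     (\<forall>a b n. gib a b (n + P) = gib a b n + m * (x * gib a b (Suc n) + y * gib a b n))"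

lemma gib_shiftI:
  assumes "gib 1 1 P = m * x" "gib 0 1 P = 1 + m * y"
  shows "gib_shift P m x y"
  unfolding gib_shift_def gib_add[of _ _ _ P] assms by (simp add: algebra_simps)

lemma gib_shift_rescale_mult:
  assumes "gib_shift P m (k * x) (k * y)"
  shows "gib_shift P (k * m) x y"
proof -
  have eq: "m * (k * x * u + k * y * v) = k * m * (x * u + y * v)" for u v
    by (simp add: algebra_simps)
  show ?thesis using assms unfolding gib_shift_def eq .
qed

lemma gib_shift_rescale: "gib_shift P 1 (m * x) (m * y) \<Longrightarrow> gib_shift P m x y"
  using gib_shift_rescale_mult[of P 1 m x y] by simp

text \<open>\<open>gib_shift P m x y\<close> says \<open>A\<^sup>P = 1 + m (x A + y)\<close> for the companion matrix \<open>A\<close>, and \<open>A\<^sup>2 = A + 1\<close>.\<close>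
lemma gib_shift_add:
  assumes "gib_shift P m x y" "gib_shift P' m x' y'"
    and X: "X = x + x' + m * (x * y' + y * x' + x * x')" and Y: "Y = y + y' + m * (x * x' + y * y')"
  shows "gib_shift (P + P') m X Y"
  unfolding gib_shift_def X Y
proof (intro allI)
  fix a b n
  let ?G = "gib a b"
  have 1: "?G (n + P) = ?G n + m * (x * ?G (Suc n) + y * ?G n)" for n
    using assms(1) by (simp add: gib_shift_def)
  have "?G (n + (P + P')) = ?G (n + P + P')" by (simp add: add.assoc)
  also have "\<dots> = ?G (n + P) + m * (x' * ?G (Suc n + P) + y' * ?G (n + P))"
    using assms(2) by (simp add: gib_shift_def)
  finally show "?G (n + (P + P')) = ?G n + m * ((x + x' + m * (x * y' + y * x' + x * x')) * ?G (Suc n)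
      + (y + y' + m * (x * x' + y * y')) * ?G n)"
    unfolding 1 gib_Suc_Suc[of a b n] by (simp add: algebra_simps)
qed

text \<open>Write C = x A + y and expand (1 + m C)^3. After division by 3 m, the terms beyond C are
  multiples of 3 because 3 divides \<open>m\<close>. Modulo 5 they vanish with C^2 when
  \<open>y\<close> is \<open>2 * x\<close>.\<close>

lemma gib_shift_times_3:
  assumes s: "gib_shift P m x y" and m: "3 dvd m"
  obtains x' y' where "gib_shift (3 * P) (3 * m) x' y'" "[x' = x] (mod 3)" "[y' = y] (mod 3)"
    "[y = 2 * x] (mod 5) \<longrightarrow> [x' = x] (mod 5) \<and> [y' = y] (mod 5)"
proof -
  obtain k where k: "m = 3 * k" using m by blast
  \<comment> \<open>These are the coordinates of C^2.\<close>
  define u v where "u = x * x + 2 * x * y" and "v = x * x + y * y"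
  define x' y' where "x' = x + 3 * (k * u + k * k * (u * y + v * x + u * x))"
    and "y' = y + 3 * (k * v + k * k * (u * x + v * y))"
  have "P + P + P = 3 * P" by simp
  moreover have "gib_shift (P + P + P) m (3 * x') (3 * y')"
    by (rule gib_shift_add[OF gib_shift_add[OF s s refl refl] s])
      (simp_all add: x'_def y'_def u_def v_def k algebra_simps)
  ultimately have 1: "gib_shift (3 * P) (3 * m) x' y'"
    using gib_shift_rescale_mult[of "3 * P" m 3 x' y'] by (simp only:)
  have 2: "[x' = x] (mod 5) \<and> [y' = y] (mod 5)" if y5: "[y = 2 * x] (mod 5)"
  proof -
    obtain j where y: "y = 2 * x + 5 * j" using cong_imp_eq_add[OF y5] by blast
    have "u = 5 * (x * x + 2 * x * j)" "v = 5 * (x * x + 4 * x * j + 5 * j * j)"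
      by (simp_all add: u_def v_def y algebra_simps)
    then have "5 dvd u" "5 dvd v" by simp_all
    then show ?thesis by (simp add: x'_def y'_def cong_iff_dvd_diff)
  qed
  have 3: "[x' = x] (mod 3)" "[y' = y] (mod 3)"
    by (simp_all add: x'_def y'_def cong_iff_dvd_diff)
  show ?thesis by (rule that[OF 1 3]) (intro impI 2)
qed

text \<open>Modulo 5, \<open>x A + y\<close> is a multiple of the nilpotent matrix \<open>A + 2\<close>, so its square vanishes.\<close>
lemma gib_shift_times_5:
  assumes s: "gib_shift P m x y" and y: "[y = 2 * x] (mod 5)"
  obtains x' y' where "gib_shift (5 * P) (5 * m) x' y'" "[x' = x] (mod 5)" "[y' = y] (mod 5)"
proof -
  obtain j where j: "y = 2 * x + 5 * j" using cong_imp_eq_add[OF y] by blast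
  \<comment> \<open>With C = x A + y, the matrix E = e A + f satisfies C^2 = 5 E; below, g A + h is
    E^2.\<close>
  define e f where "e = x * x + 2 * x * j" and "f = x * x + 4 * x * j + 5 * j * j"
  have e: "x * x + 2 * x * y = 5 * e" and f: "x * x + y * y = 5 * f"
    by (simp_all add: e_def f_def j algebra_simps)
  define g h where "g = e * e + 2 * e * f" and "h = e * e + f * f"
  \<comment> \<open>These are the coordinates of ((1 + m C)^5 - 1) / (5 m), by the binomial
    expansion.\<close>
  define x' where "x' = x + 5 * (2 * m * e + 2 * m * m * (e * y + f * x + e * x) + 5 * m * m * m * g
    + m * m * m * m * (g * y + h * x + g * x))"
  define y' where "y' = y + 5 * (2 * m * f + 2 * m * m * (e * x + f * y) + 5 * m * m * m * h
    + m * m * m * m * (g * x + h * y))"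
  have s2: "gib_shift (P + P) m (2 * x + 5 * m * e) (2 * y + 5 * m * f)"
    by (rule gib_shift_add[OF s s]) (simp_all add: e_def f_def j algebra_simps)
  have "gib_shift (P + P + (P + P) + P) m (5 * x') (5 * y')"
    by (rule gib_shift_add[OF gib_shift_add[OF s2 s2 refl refl] s])
      (simp_all add: x'_def y'_def e_def f_def g_def h_def j algebra_simps)
  moreover have "P + P + (P + P) + P = 5 * P" by simp
  ultimately have 1: "gib_shift (5 * P) (5 * m) x' y'"
    using gib_shift_rescale_mult[of "5 * P" m 5 x' y'] by simp
  have 3: "[x' = x] (mod 5)" "[y' = y] (mod 5)"
    by (simp_all add: x'_def y'_def cong_iff_dvd_diff)
  show ?thesis by (rule that[OF 1 3])
qed

lemma gib_shift_cong:
  assumes "gib_shift P m x y"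
  shows "[gib a b (n + t * P) = gib a b n] (mod m)"
proof (induction t)
  case (Suc t)
  have "gib a b (n + Suc t * P) = gib a b (n + t * P + P)" by (simp add: algebra_simps)
  also have "[\<dots> = gib a b (n + t * P)] (mod m)"
    using assms by (simp add: gib_shift_def cong_iff_dvd_diff)
  finally show ?case using Suc.IH by (rule cong_trans)
qed simp

text \<open>Since \<open>H\<close> has period \<open>P\<close> modulo \<open>q\<close>, going on by
  \<open>t * P\<close> adds \<open>t * m * H n\<close> modulo \<open>q * m\<close>. As
  \<open>H n\<close> is a unit modulo \<open>q\<close>, a suitable \<open>t\<close> reaches any lift
  of the residue.\<close>

lemma gib_lift:
  fixes q m :: int
  assumes s: "gib_shift P m x y" and q: "prime q"
    and H: "\<And>n. H n = x * gib a b (Suc n) + y * gib a b n"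
    and per: "\<And>n. [H (n + P) = H n] (mod q)" and unit: "\<not> q dvd H n"
    and r: "[gib a b n = r] (mod m)"
  shows "\<exists>t. [gib a b (n + t * P) = r] (mod q * m)"
proof -
  have H_per: "[H (n + t * P) = H n] (mod q)" for t
  proof (induction t)
    case (Suc t)
    have "H (n + Suc t * P) = H (n + t * P + P)" by (simp add: algebra_simps)
    then show ?case using per[of "n + t * P"] Suc.IH by (metis cong_trans)
  qed simp
  have lin: "[gib a b (n + t * P) = gib a b n + m * (int t * H n)] (mod q * m)" for t
  proof (induction t)
    case (Suc t)
    have "[m * H (n + t * P) = m * H n] (mod q * m)"
      using cong_cmult_leftI[OF H_per[of t], of m] by (simp add: mult.commute)
    from cong_add[OF Suc.IH this]
    have "[gib a b (n + t * P) + m * H (n + t * P) = gib a b n + m * (int (Suc t) * H n)] (mod q * m)"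
      by (simp add: algebra_simps)
    moreover have "gib a b (n + Suc t * P) = gib a b (n + t * P + P)" by (simp add: algebra_simps)
    moreover have "gib a b (n + t * P + P) = gib a b (n + t * P) + m * H (n + t * P)"
      using s unfolding gib_shift_def H by blast
    ultimately show ?case by simp
  qed simp
  obtain c where c: "r = gib a b n + m * c" using cong_imp_eq_add[OF cong_sym[OF r]] by blast
  have "coprime (H n) q" using q unit by (metis coprime_commute prime_imp_coprime)
  then obtain d where d: "[H n * d = 1] (mod q)" using cong_solve_coprime_int by blast
  \<comment> \<open>With \<open>d\<close> inverse to \<open>H n\<close>, this solves
    \<open>t * H n = c\<close> modulo \<open>q\<close> in natural numbers.\<close>
  define t where "t = nat ((c * d) mod q)"
  have "q > 0" using q prime_gt_0_int by blast
  then have t: "[int t = c * d] (mod q)" by (simp add: t_def)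
  have "[int t * H n = c * d * H n] (mod q)" by (intro cong_mult t cong_refl)
  also have "c * d * H n = c * (H n * d)" by (simp add: ac_simps)
  also have "[\<dots> = c * 1] (mod q)" by (intro cong_mult d cong_refl)
  finally have "[int t * H n = c] (mod q)" by simp
  then have "[m * (int t * H n) = m * c] (mod q * m)"
    using cong_cmult_leftI[of "int t * H n" c q m] by (simp add: mult.commute)
  then have "[gib a b n + m * (int t * H n) = r] (mod q * m)" unfolding c by (intro cong_add cong_refl)
  then show ?thesis using lin[of t] cong_trans by blast
qed

text \<open>Modulo 5, \<open>H n\<close> is \<open>x\<close> times \<open>G(n+1) + 2 G(n)\<close>,
  and minus the square of the latter factor is the invariant form. So \<open>H n\<close> is a unit
  when 5 does not divide \<open>D\<close>.\<close>

lemma complete_mod_times_5: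
  assumes s: "gib_shift P m x y" and P: "4 dvd P" and y: "[y = 2 * x] (mod 5)" and x: "\<not> 5 dvd x"
    and D: "\<not> 5 dvd a\<^sup>2 + a * b - b\<^sup>2" and c: "complete_mod a b m"
  shows "complete_mod a b (5 * m)"
  unfolding complete_mod_def
proof
  fix r
  define H where "H n = x * gib a b (Suc n) + y * gib a b n" for n
  obtain j where j: "y = 2 * x + 5 * j" using cong_imp_eq_add[OF y] by blast
  have H_Suc: "[H (Suc n) = 3 * H n] (mod 5)" for n
    by (simp add: H_def gib_Suc_Suc cong_iff_dvd_diff j algebra_simps)
  \<comment> \<open>The factor 3 has order 4 modulo 5; hence the requirement
    \<open>4 dvd P\<close>.\<close>
  have H4: "[H (n + 4 * k) = H n] (mod 5)" for n k
  proof (induction k)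
    case (Suc k)
    have "[H (Suc (Suc (Suc (Suc (n + 4 * k))))) = 3 * (3 * (3 * (3 * H (n + 4 * k))))] (mod 5)"
      by (meson H_Suc cong_scalar_left cong_trans)
    also have "[3 * (3 * (3 * (3 * H (n + 4 * k)))) = H (n + 4 * k)] (mod 5)"
      by (simp add: cong_iff_dvd_diff)
    also have "Suc (Suc (Suc (Suc (n + 4 * k)))) = n + 4 * Suc k" by simp
    finally show ?case using Suc.IH by (rule cong_trans)
  qed simp
  have unit: "\<not> 5 dvd H n" for n
  proof
    assume "5 dvd H n"
    moreover have "H n = x * (gib a b (Suc n) + 2 * gib a b n) + 5 * (j * gib a b n)"
      by (simp add: H_def j algebra_simps)
    ultimately have "5 dvd x * (gib a b (Suc n) + 2 * gib a b n)"
      by (metis dvd_add_left_iff dvd_triv_left)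
    moreover have "prime (5::int)" by simp
    ultimately have "5 dvd gib a b (Suc n) + 2 * gib a b n"
      using x prime_dvd_mult_iff by blast
    then obtain i where "gib a b (Suc n) + 2 * gib a b n = 5 * i" by (rule dvdE)
    then have i: "gib a b (Suc n) = 5 * i - 2 * gib a b n" by simp
    have "(gib a b n)\<^sup>2 + gib a b n * gib a b (Suc n) - (gib a b (Suc n))\<^sup>2
        = 5 * (5 * i * gib a b n - 5 * i * i - (gib a b n)\<^sup>2)"
      unfolding i by (simp add: power2_eq_square algebra_simps)
    then have "5 dvd (-1) ^ Suc n * (a\<^sup>2 + a * b - b\<^sup>2)" unfolding gib_form by (simp only: dvd_triv_left)
    moreover have "(-1::int) ^ Suc n = 1 \<or> (-1::int) ^ Suc n = -1" by (cases "even n") simp_all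
    ultimately show False using D by (metis dvd_minus_iff mult_1 mult_minus1)
  qed
  obtain n where n: "n \<ge> 1" "[gib a b n = r] (mod m)" using c unfolding complete_mod_def by blast
  have "\<exists>t. [gib a b (n + t * P) = r] (mod 5 * m)"
    by (rule gib_lift[OF s _ H_def _ unit n(2)]) (use P H4 in auto)
  then show "\<exists>n\<ge>1. [gib a b n = r] (mod 5 * m)" using n(1) by (meson trans_le_add1)
qed

lemma cong_linear_transfer:
  fixes x :: int
  assumes "[x' = x] (mod q)" "[y' = y] (mod q)" "[y = c * x] (mod q)" "\<not> q dvd x"
  shows "[y' = c * x'] (mod q) \<and> \<not> q dvd x'"
proof -
  have "[c * x = c * x'] (mod q)" by (intro cong_scalar_left cong_sym[OF assms(1)])
  then have "[y' = c * x'] (mod q)" using assms(2,3) cong_trans by blast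
  then show ?thesis using cong_dvd_iff[OF assms(1)] assms(4) by blast
qed

lemma complete_mod_times_power_5:
  assumes "gib_shift P m x y" "4 dvd P" "[y = 2 * x] (mod 5)" "\<not> 5 dvd x"
    and D: "\<not> 5 dvd a\<^sup>2 + a * b - b\<^sup>2" and "complete_mod a b m"
  shows "complete_mod a b (m * 5 ^ k)"
proof -
  \<comment> \<open>The period grows with \<open>k\<close> and the coordinates change, so they
    belong to the induction claim.\<close>
  have "\<exists>P x y. gib_shift P (m * 5 ^ k) x y \<and> 4 dvd P \<and> [y = 2 * x] (mod 5) \<and> \<not> 5 dvd x
      \<and> complete_mod a b (m * 5 ^ k)"
  proof (induction k)
    case 0
    then show ?case using assms by auto
  next
    case (Suc k)
    then obtain P x y where IH: "gib_shift P (m * 5 ^ k) x y" "4 dvd P" "[y = 2 * x] (mod 5)" "\<not> 5 dvd x"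
      "complete_mod a b (m * 5 ^ k)" by blast
    obtain x' y' where s': "gib_shift (5 * P) (5 * (m * 5 ^ k)) x' y'" "[x' = x] (mod 5)" "[y' = y] (mod 5)"
      using gib_shift_times_5[OF IH(1,3)] .
    have "[y' = 2 * x'] (mod 5)" "\<not> 5 dvd x'" using cong_linear_transfer[OF s'(2,3) IH(3,4)] by blast+
    moreover have "complete_mod a b (5 * (m * 5 ^ k))" using complete_mod_times_5[OF IH(1-4) D IH(5)] .
    moreover have "4 dvd 5 * P" using IH(2) by simp
    ultimately show ?case unfolding power_Suc mult.left_commute[of m 5] using s'(1) by blast
  qed
  then show ?thesis by blast
qed

section \<open>Base cases by enumeration\<close>

text \<open>An executable search through \<open>k\<close> steps of the orbit modulo
  \<open>m\<close>. \<open>Q\<close> sees pairs of neighbours, since the base case for powers of 3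
  also constrains the following terms.\<close>

fun orbit_meets :: "(int \<Rightarrow> int \<Rightarrow> bool) \<Rightarrow> int \<Rightarrow> nat \<Rightarrow> int \<Rightarrow> int \<Rightarrow> bool" where
  "orbit_meets Q m 0 x y = False"
| "orbit_meets Q m (Suc k) x y = (Q x y \<or> orbit_meets Q m k y ((x + y) mod m))"

lemma orbit_meets_gib:
  "orbit_meets Q m k (gib a b n mod m) (gib a b (Suc n) mod m) \<Longrightarrow>
     \<exists>i\<ge>n. Q (gib a b i mod m) (gib a b (Suc i) mod m)"
proof (induction k arbitrary: n)
  case (Suc k)
  have "(gib a b n mod m + gib a b (Suc n) mod m) mod m = gib a b (Suc (Suc n)) mod m"
    by (simp add: gib_Suc_Suc mod_simps)
  then have "Q (gib a b n mod m) (gib a b (Suc n) mod m) \<or>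
      orbit_meets Q m k (gib a b (Suc n) mod m) (gib a b (Suc (Suc n)) mod m)"
    using Suc.prems by simp
  then show ?case using Suc.IH[of "Suc n"] by (metis Suc_leD order_refl)
qed simp

lemma gib_meets:
  assumes gcd: "gcd a b = 1" and m: "m > 0"
    and all: "\<forall>x\<in>set [0..m - 1]. \<forall>y\<in>set [0..m - 1]. gcd (gcd x y) m = 1 \<longrightarrow>
      (\<forall>r\<in>set [0..m - 1]. orbit_meets (Q r) m k x y)"
  shows "\<exists>n\<ge>1. Q (r mod m) (gib a b n mod m) (gib a b (Suc n) mod m)"
proof -
  have "gcd (gcd (a mod m) (b mod m)) m = 1"
    by (metis gcd gcd.assoc gcd.commute gcd_1_int gcd_red_int)
  then have "orbit_meets (Q (r mod m)) m k (gib a b 1 mod m) (gib a b (Suc 1) mod m)"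
    using all m by simp
  then show ?thesis by (rule orbit_meets_gib)
qed

lemma complete_modI_orbit:
  assumes "gcd a b = 1" "m > 0"
    and "\<forall>x\<in>set [0..m - 1]. \<forall>y\<in>set [0..m - 1]. gcd (gcd x y) m = 1 \<longrightarrow>
      (\<forall>r\<in>set [0..m - 1]. orbit_meets (\<lambda>u v. u = r) m k x y)"
  shows "complete_mod a b m"
  unfolding complete_mod_def cong_def using gib_meets[OF assms] by blast

text \<open>The bounds 6, 24 and 48 here and below are the Fibonacci periods modulo 4, 6 and
  14.\<close>

lemma complete_mod_4: "gcd a b = 1 \<Longrightarrow> complete_mod a b 4"
  by (erule complete_modI_orbit[where k = 6], simp) code_simp

lemma complete_mod_6: "gcd a b = 1 \<Longrightarrow> complete_mod a b 6"
  by (erule complete_modI_orbit[where k = 24], simp) code_simp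

lemma complete_mod_14: "gcd a b = 1 \<Longrightarrow> complete_mod a b 14"
  by (erule complete_modI_orbit[where k = 48], simp) code_simp

text \<open>For modulus 1 the coordinates are F(P) and F(P-1) - 1; rescaling later moves common
  factors into the modulus.\<close>

lemma gib_shift_8: "gib_shift 8 1 21 12"
  by (rule gib_shiftI) (simp_all add: eval_nat_numeral)

lemma gib_shift_12: "gib_shift 12 1 144 88"
  by (rule gib_shiftI) (simp_all add: eval_nat_numeral)

lemma gib_shift_24: "gib_shift 24 1 46368 28656"
  using gib_shift_add[OF gib_shift_12 gib_shift_12 refl refl] by simp

lemma gib_shift_48: "gib_shift 48 1 4807526976 2971215072"
  using gib_shift_add[OF gib_shift_24 gib_shift_24 refl refl] by simp

text \<open>The period is 12 rather than 6 because lifting by 5 needs \<open>4 dvd P\<close>; 36 and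
  22 are 144 / 4 and 88 / 4.\<close>

lemma complete_mod_4_times_power_5:
  assumes "gcd a b = 1" "\<not> 5 dvd a\<^sup>2 + a * b - b\<^sup>2"
  shows "complete_mod a b (4 * 5 ^ k)"
  by (rule complete_mod_times_power_5[OF gib_shift_rescale[of 12 4 36 22] _ _ _ assms(2)])
    (use complete_mod_4[OF assms(1)] gib_shift_12 in \<open>simp_all add: cong_def\<close>)

lemma complete_mod_6_times_power_5:
  assumes "gcd a b = 1" "\<not> 5 dvd a\<^sup>2 + a * b - b\<^sup>2"
  shows "complete_mod a b (6 * 5 ^ k)"
  by (rule complete_mod_times_power_5[OF gib_shift_rescale[of 24 6 7728 4776] _ _ _ assms(2)])
    (use complete_mod_6[OF assms(1)] gib_shift_24 in \<open>simp_all add: cong_def\<close>)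

lemma complete_mod_14_times_power_5:
  assumes "gcd a b = 1" "\<not> 5 dvd a\<^sup>2 + a * b - b\<^sup>2"
  shows "complete_mod a b (14 * 5 ^ k)"
  by (rule complete_mod_times_power_5[OF gib_shift_rescale[of 48 14 343394784 212229648] _ _ _ assms(2)])
    (use complete_mod_14[OF assms(1)] gib_shift_48 in \<open>simp_all add: cong_def\<close>)

text \<open>Lifting from \<open>3\<^sup>j\<close> to \<open>3\<^sup>j\<^sup>+\<^sup>1\<close> along the orbit of \<open>n\<close> needs \<open>3 \<nmid> G\<^bsub>n+2\<^esub>\<close>, a condition that the lifting
  preserves.\<close>
lemma power_3_chain:
  assumes "gcd a b = 1"
  shows "\<exists>P x y. gib_shift P (3 ^ Suc j) x y \<and> 4 dvd P \<and> [y = 2 * x] (mod 5) \<and> \<not> 5 dvd x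
    \<and> [y = x] (mod 3) \<and> \<not> 3 dvd x
    \<and> (\<forall>r. \<exists>n\<ge>1. [gib a b n = r] (mod 3 ^ Suc j) \<and> \<not> 3 dvd gib a b (Suc (Suc n)))"
proof (induction j)
  case 0
  \<comment> \<open>The period modulo 3 is 8, and \<open>u + v\<close> is the term two places after
    the one that hits \<open>r\<close>.\<close>
  have "\<forall>x\<in>set [0..3 - 1]. \<forall>y\<in>set [0..3 - 1]. gcd (gcd x y) 3 = 1 \<longrightarrow>
      (\<forall>r\<in>set [0..3 - 1]. orbit_meets (\<lambda>u v. u = r \<and> (u + v) mod 3 \<noteq> 0) 3 8 x y)"
    by code_simp
  from gib_meets[OF assms _ this]
  have "\<exists>n\<ge>1. gib a b n mod 3 = r mod 3 \<and> (gib a b n mod 3 + gib a b (Suc n) mod 3) mod 3 \<noteq> 0" for r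
    by simp
  then have "\<forall>r. \<exists>n\<ge>1. [gib a b n = r] (mod 3) \<and> \<not> 3 dvd gib a b (Suc (Suc n))"
    by (simp add: cong_def gib_Suc_Suc mod_simps dvd_eq_mod_eq_0)
  moreover have "gib_shift 8 3 7 4" using gib_shift_rescale[of 8 3 7 4] gib_shift_8 by simp
  ultimately show ?case
    by (intro exI[of _ 8] exI[of _ 7] exI[of _ 4]) (simp add: cong_def)
next
  case (Suc j)
  then obtain P x y where s: "gib_shift P (3 ^ Suc j) x y" and P: "4 dvd P"
    and mod5: "[y = 2 * x] (mod 5)" "\<not> 5 dvd x" and mod3: "[y = x] (mod 3)" "\<not> 3 dvd x"
    and hit: "\<And>r. \<exists>n\<ge>1. [gib a b n = r] (mod 3 ^ Suc j) \<and> \<not> 3 dvd gib a b (Suc (Suc n))"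
    by blast
  have dvd3: "3 dvd (3::int) ^ Suc j" by simp
  obtain x' y' where s': "gib_shift (3 * P) (3 * 3 ^ Suc j) x' y'" "[x' = x] (mod 3)" "[y' = y] (mod 3)"
    "[y = 2 * x] (mod 5) \<longrightarrow> [x' = x] (mod 5) \<and> [y' = y] (mod 5)"
    using gib_shift_times_3[OF s dvd3] .
  \<comment> \<open>The congruences modulo 5 are carried along for the later lifts by 5.\<close>
  then have s'5: "[x' = x] (mod 5)" "[y' = y] (mod 5)" using mod5(1) by blast+
  have lin: "[y' = 2 * x'] (mod 5)" "\<not> 5 dvd x'" "[y' = x'] (mod 3)" "\<not> 3 dvd x'"
    using cong_linear_transfer[OF s'5 mod5] cong_linear_transfer[OF s'(2,3), of 1] mod3 by auto
  have hit': "\<exists>n\<ge>1. [gib a b n = r] (mod 3 * 3 ^ Suc j) \<and> \<not> 3 dvd gib a b (Suc (Suc n))" for r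
  proof -
    define H where "H n = x * gib a b (Suc n) + y * gib a b n" for n
    obtain n where n: "n \<ge> 1" "[gib a b n = r] (mod 3 ^ Suc j)" "\<not> 3 dvd gib a b (Suc (Suc n))"
      using hit by blast
    obtain i where i: "y = x + 3 * i" using cong_imp_eq_add[OF mod3(1)] by blast
    \<comment> \<open>Since \<open>y\<close> is congruent to \<open>x\<close> modulo 3,
      \<open>H n\<close> is \<open>x\<close> times the term at \<open>n + 2\<close> modulo
      3.\<close>
    have H: "H n = x * gib a b (Suc (Suc n)) + 3 * (i * gib a b n)"
      by (simp add: H_def gib_Suc_Suc i algebra_simps)
    have "prime (3::int)" by simp
    then have unit: "\<not> 3 dvd H n"
      unfolding H using mod3(2) n(3) by (simp add: dvd_add_left_iff prime_dvd_mult_iff)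
    have gib3: "[gib a b (n + t * P) = gib a b n] (mod 3)" for n t
      using cong_dvd_modulus[OF gib_shift_cong[OF s] dvd3] .
    have per: "[H (n + P) = H n] (mod 3)" for n
      using gib3[of n 1] gib3[of "Suc n" 1] by (auto simp: H_def intro!: cong_add cong_mult)
    obtain t where t: "[gib a b (n + t * P) = r] (mod 3 * 3 ^ Suc j)"
      using gib_lift[OF s \<open>prime 3\<close> H_def per unit n(2)] by blast
    have "\<not> 3 dvd gib a b (Suc (Suc (n + t * P)))"
      using n(3) gib3[of "Suc (Suc n)" t] by (simp add: cong_dvd_iff)
    then show ?thesis using t n(1) by (meson trans_le_add1)
  qed
  have P': "4 dvd 3 * P" using P by simp
  show ?case unfolding power_Suc[of 3 "Suc j"]
    by (rule exI[of _ "3 * P"], rule exI[of _ x'], rule exI[of _ y'], intro conjI allI s'(1) lin hit' P')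
qed

lemma complete_mod_power_3: "gcd a b = 1 \<Longrightarrow> complete_mod a b (3 ^ Suc j)"
  using power_3_chain[of a b j] unfolding complete_mod_def by meson

lemma complete_mod_power_3_times_power_5:
  assumes "gcd a b = 1" "\<not> 5 dvd a\<^sup>2 + a * b - b\<^sup>2"
  shows "complete_mod a b (3 ^ Suc j * 5 ^ k)"
proof -
  obtain P x y where "gib_shift P (3 ^ Suc j) x y" "4 dvd P" "[y = 2 * x] (mod 5)" "\<not> 5 dvd x"
    using power_3_chain[OF assms(1), of j] by blast
  then show ?thesis
    using complete_mod_power_3[OF assms(1)] by (rule complete_mod_times_power_5[OF _ _ _ _ assms(2)])
qed

section \<open>The sets of complete moduli\<close>

text \<open>The modulus 5 itself is incomplete here, which forces \<open>k = 0\<close> in the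
  classification.\<close>

lemma Mset_eq_if_5_dvd_form:
  assumes gcd: "gcd a b = 1" and D: "5 dvd a\<^sup>2 + a * b - b\<^sup>2"
  shows "Mset a b = {2, 4, 6, 7, 14} \<union> {3 ^ j | j::nat. j \<ge> 1}"
proof (intro equalityI subsetI)
  fix m assume "m \<in> Mset a b"
  then have m: "m \<ge> 2" "complete_mod a b m" by (simp_all add: Mset_def)
  then have "m > 0" by simp
  obtain c k where ck: "m = c * 5 ^ k" "c \<in> {1, 2, 4, 6, 7, 14} \<or> (\<exists>j\<ge>1. c = 3 ^ j)"
    using complete_mod_classification[OF gcd \<open>m > 0\<close> m(2)] .
  have "\<not> complete_mod a b 5" using not_complete_mod_if_dvd_form[OF gcd _ D] by simp
  then have "\<not> 5 dvd m" using complete_mod_dvd[OF m(2)] by blast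
  then have "k = 0" unfolding ck by (cases k) simp_all
  then show "m \<in> {2, 4, 6, 7, 14} \<union> {3 ^ j | j::nat. j \<ge> 1}" using ck m(1) by auto
next
  fix m :: int assume m: "m \<in> {2, 4, 6, 7, 14} \<union> {3 ^ j | j::nat. j \<ge> 1}"
  have "complete_mod a b 2" using complete_mod_dvd[OF complete_mod_4[OF gcd]] by simp
  moreover have "complete_mod a b 7" using complete_mod_dvd[OF complete_mod_14[OF gcd]] by simp
  moreover have "complete_mod a b (3 ^ j) \<and> (2::int) \<le> 3 ^ j" if "j \<ge> 1" for j
  proof -
    have "(3::int) ^ 1 \<le> 3 ^ j" using that by (intro power_increasing) simp_all
    then show ?thesis using complete_mod_power_3[OF gcd, of "j - 1"] that by simp
  qed
  ultimately show "m \<in> Mset a b"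
    using m complete_mod_4[OF gcd] complete_mod_6[OF gcd] complete_mod_14[OF gcd]
    by (auto simp: Mset_def)
qed

lemma Mset_eq_if_not_5_dvd_form:
  assumes gcd: "gcd a b = 1" and D: "\<not> 5 dvd a\<^sup>2 + a * b - b\<^sup>2"
  shows "Mset a b = ({5^k | k::nat. True} \<union> {2*5^k | k::nat. True} \<union> {4*5^k | k::nat. True}
      \<union> {3^j*5^k | j k::nat. j \<ge> 1} \<union> {6*5^k | k::nat. True}
      \<union> {7*5^k | k::nat. True} \<union> {14*5^k | k::nat. True}) - {1}" (is "_ = ?S - {1}")
proof (intro equalityI subsetI)
  fix m assume "m \<in> Mset a b"
  then have m: "m \<ge> 2" "complete_mod a b m" by (simp_all add: Mset_def)
  then have "m > 0" by simp
  obtain c k where "m = c * 5 ^ k" "c \<in> {1, 2, 4, 6, 7, 14} \<or> (\<exists>j\<ge>1. c = 3 ^ j)"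
    using complete_mod_classification[OF gcd \<open>m > 0\<close> m(2)] .
  then have "m \<in> ?S" by auto
  then show "m \<in> ?S - {1}" using m(1) by simp
next
  fix m :: int assume m: "m \<in> ?S - {1}"
  then obtain c k where ck: "m = c * 5 ^ k" "c \<in> {1, 2, 4, 6, 7, 14} \<or> (\<exists>j\<ge>1. c = 3 ^ j)"
    by force
  have "complete_mod a b m \<and> c > 0"
    using ck(2)
  proof
    assume c: "c \<in> {1, 2, 4, 6, 7, 14}"
    \<comment> \<open>Only the maximal values 4, 6 and 14 were lifted; the others are
      divisors.\<close>
    have "c dvd 4 \<or> c dvd 6 \<or> c dvd 14" using c by auto
    then have "m dvd 4 * 5 ^ k \<or> m dvd 6 * 5 ^ k \<or> m dvd 14 * 5 ^ k"
      unfolding ck(1) by (auto intro: mult_dvd_mono)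
    then have "complete_mod a b m"
      using complete_mod_dvd complete_mod_4_times_power_5[OF gcd D] complete_mod_6_times_power_5[OF gcd D]
        complete_mod_14_times_power_5[OF gcd D] by blast
    then show ?thesis using c by auto
  next
    assume "\<exists>j\<ge>1. c = 3 ^ j"
    then obtain j where "c = 3 ^ Suc j" by (metis One_nat_def Suc_le_D)
    then show ?thesis using ck(1) complete_mod_power_3_times_power_5[OF gcd D, of j k] by simp
  qed
  moreover have "m > 0" using calculation ck(1) by simp
  ultimately show "m \<in> Mset a b" using m by (simp add: Mset_def)
qed

theorem mainTheorem16:
  fixes a b :: int
  assumes "gcd a b = 1"
  shows "(5 dvd (a^2 + a*b - b^2) \<longrightarrow>
            Mset a b = Mset 1 3 \<and>
            Mset 1 3 = {2, 4, 6, 7, 14} \<union> {3^j | j::nat. j \<ge> 1})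
       \<and> (\<not> 5 dvd (a^2 + a*b - b^2) \<longrightarrow>
            Mset a b = Mset 1 1 \<and>
            Mset 1 1 = ({5^k | k::nat. True} \<union> {2*5^k | k::nat. True} \<union> {4*5^k | k::nat. True}
                        \<union> {3^j*5^k | j k::nat. j \<ge> 1} \<union> {6*5^k | k::nat. True}
                        \<union> {7*5^k | k::nat. True} \<union> {14*5^k | k::nat. True}) - {1})"
proof -
  \<comment> \<open>The form value is -5 for the Lucas sequence and 1 for the Fibonacci
    sequence.\<close>
  have L: "Mset 1 3 = {2, 4, 6, 7, 14} \<union> {3 ^ j | j::nat. j \<ge> 1}"
    by (rule Mset_eq_if_5_dvd_form) simp_all
  have F: "Mset 1 1 = ({5^k | k::nat. True} \<union> {2*5^k | k::nat. True} \<union> {4*5^k | k::nat. True}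
      \<union> {3^j*5^k | j k::nat. j \<ge> 1} \<union> {6*5^k | k::nat. True}
      \<union> {7*5^k | k::nat. True} \<union> {14*5^k | k::nat. True}) - {1}"
    by (rule Mset_eq_if_not_5_dvd_form) simp_all
  show ?thesis
  proof (intro conjI impI)
    assume "5 dvd a^2 + a*b - b^2"
    then show "Mset a b = Mset 1 3" unfolding L by (rule Mset_eq_if_5_dvd_form[OF assms])
  next
    assume "\<not> 5 dvd a^2 + a*b - b^2"
    then show "Mset a b = Mset 1 1" unfolding F by (rule Mset_eq_if_not_5_dvd_form[OF assms])
  qed (rule L F)+
qed

end
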